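(* For all integers $n,k$ with $n\ge k\ge 1$ and $k-1\ge 1$, the Ward-Lah numbers $W(n,k)$ satisfy $$W(n,k)=\frac{(n+k)(n-1)}{n}\left(W(n-1,k)+\frac{n+k-1}{k-1}\,W(n-1,k-1)\right).$$
   Context: Partition transformation: for integers $n,k\ge 0$ and a sequence $a_1,a_2,\dots$, $$P_n^k(a_1,a_2,\dots)=\sum_{q}(-1)^{q_0}\prod_{j=0}^{\ell(q)-1}\binom{q_j}{q_{j+1}}a_{j+1}^{q_j},$$ where the sum is over integer partitions $q=(q_0\ge q_1\ge\dots)$ of $n=q_0+q_1+\cdots$ with $q_0=k$; $\ell(q)$ is the length of $q$ (number of positive parts), so $q_{\ell(q)-1}>0$ and $q_{\ell(q)}=0$. Falling factorial: $x^{\underline{n}}=\prod_{i=0}^{n-1}(x-i)$. Ward-Lah numbers: for integers $n\ge k\ge 0$, $W(n,k)=(-1)^k (n+k)^{\underline{n}}\,P_n^k(1,1,\dots)$ (all $a_i=1$), with $W(0,0)=1$, $W(n,0)=0$ for $n\ge 1$, $W(0,k)=0$ for $k\ge 1$, and $W(n,k)=0$ for $k>n$. *)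

theory Defs
  imports Complex_Main
begin

text \<open>
  An integer partition \<open>q\<^sub>0 \<ge> q\<^sub>1 \<ge> \<dots>\<close> of \<open>n\<close> is a weakly decreasing sequence of naturals,
  indexed from \<open>0\<close> and padded with zeros beyond its length; the empty partition is the zero
  sequence.
\<close>

definition int_partitions :: "nat \<Rightarrow> (nat \<Rightarrow> nat) set" where
  "int_partitions n = {q. antimono q \<and> finite {j. q j > 0} \<and> (\<Sum>j | q j > 0. q j) = n}"

definition partition_length :: "(nat \<Rightarrow> nat) \<Rightarrow> nat" where
  "partition_length q = card {j. q j > 0}"

text \<open>
  The sequence \<open>a\<^sub>1, a\<^sub>2, \<dots>\<close> is a function on the naturals whose value at \<open>0\<close> is never used.
\<close>

definition partition_transform :: "nat \<Rightarrow> nat \<Rightarrow> (nat \<Rightarrow> 'a::comm_ring_1) \<Rightarrow> 'a" where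
  "partition_transform n k a =
     (\<Sum>q \<in> {q \<in> int_partitions n. q 0 = k}.
        (-1) ^ q 0 *
        (\<Prod>j = 0..<partition_length q. of_nat (q j choose q (j + 1)) * a (j + 1) ^ q j))"

definition falling_factorial :: "'a::comm_ring_1 \<Rightarrow> nat \<Rightarrow> 'a" where
  "falling_factorial x n = (\<Prod>i = 0..<n. x - of_nat i)"

text \<open>
  The boundary values \<open>W(0,0) = 1\<close>, \<open>W(n,0) = 0\<close> for \<open>n \<ge> 1\<close> agree with the general formula
  (see the lemmas below), so only the convention for \<open>k > n\<close> needs a separate case.
\<close>

definition ward_lah :: "nat \<Rightarrow> nat \<Rightarrow> int" where
  "ward_lah n k =
     (if k > n then 0
      else (-1) ^ k * falling_factorial (int (n + k)) n * partition_transform n k (\<lambda>_. 1))"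

text \<open>Otherwise the sum in \<open>partition_transform\<close> would be \<open>0\<close> by convention.\<close>

lemma finite_int_partitions: "finite (int_partitions n)"
proof -
  have bound: "q j \<le> n" and vanish: "j \<ge> n \<Longrightarrow> q j = 0" if q: "q \<in> int_partitions n" for q j
  proof -
    have anti: "antimono q" and fin: "finite {j. q j > 0}" and s: "(\<Sum>j | q j > 0. q j) = n"
      using q by (auto simp: int_partitions_def)
    show "q j \<le> n"
    proof (cases "q j > 0")
      case True
      then show ?thesis using member_le_sum[of j "{j. q j > 0}" q] fin s by auto
    qed simp
    show "q j = 0" if "j \<ge> n"
    proof (rule ccontr)
      assume "q j \<noteq> 0"
      then have "{..j} \<subseteq> {j. q j > 0}"
        by (auto dest: antimonoD[OF anti, of _ j])
      then have "card {..j} \<le> card {j. q j > 0}" using fin card_mono by blast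
      also have "\<dots> \<le> (\<Sum>j | q j > 0. q j)"
        using sum_mono[of "{j. q j > 0}" "\<lambda>_. 1" q] by auto
      finally show False using s that by simp
    qed
  qed
  have "int_partitions n \<subseteq> {q. \<forall>j. (j \<in> {..<n} \<longrightarrow> q j \<in> {..n}) \<and> (j \<notin> {..<n} \<longrightarrow> q j = 0)}"
    using bound vanish by auto
  then show ?thesis
    using finite_set_of_finite_funs[of "{..<n}" "{..n}" 0] finite_subset by blast
qed

lemma int_partitions_0: "{q \<in> int_partitions n. q 0 = 0} = (if n = 0 then {\<lambda>_. 0} else {})"
proof -
  have zero: "q = (\<lambda>_. 0)" if "q \<in> int_partitions n" "q 0 = 0" for q
  proof
    fix j
    have "antimono q" using that(1) by (simp add: int_partitions_def)
    then have "q j \<le> q 0" by (rule antimonoD) simp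
    then show "q j = 0" using that(2) by simp
  qed
  have "(\<lambda>_. 0) \<in> int_partitions n \<longleftrightarrow> n = 0"
    by (auto simp: int_partitions_def antimono_def)
  moreover have "{q \<in> int_partitions n. q 0 = 0} = {q. q = (\<lambda>_. 0) \<and> q \<in> int_partitions n}"
    by (rule Collect_cong) (blast intro: zero dest: fun_cong)
  moreover have "\<dots> = (if (\<lambda>_. 0) \<in> int_partitions n then {\<lambda>_. 0} else {})"
    by (rule Collect_conv_if)
  ultimately show ?thesis by (simp only:)
qed

lemma ward_lah_0_0: "ward_lah 0 0 = 1"
  by (simp add: ward_lah_def partition_transform_def falling_factorial_def partition_length_def
      int_partitions_0)

lemma ward_lah_n_0: "n \<ge> 1 \<Longrightarrow> ward_lah n 0 = 0"
  by (simp add: ward_lah_def partition_transform_def int_partitions_0)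

lemma ward_lah_0_k: "k \<ge> 1 \<Longrightarrow> ward_lah 0 k = 0"
  by (simp add: ward_lah_def)

end

theory Submission imports Defs begin

text \<open>
  Reading \<open>q\<^sub>j\<close> as the number of parts greater than \<open>j\<close>, the product of the binomials
  \<open>q\<^sub>j choose q\<^sub>j\<^sub>+\<^sub>1\<close> counts the compositions with this profile, so that
  \<open>P\<^sub>n\<^sup>k(1,1,\<dots>) = (-1)\<^sup>k (n - 1 choose k - 1)\<close>. This is obtained here from a recursion that
  removes \<open>q\<^sub>0\<close>, together with Vandermonde's identity. Hence
  \<open>W(n,k) = (n + k)! / k! \<cdot> (n - 1 choose k - 1)\<close>, and the recurrence reduces to the absorption
  identities for binomial coefficients.
\<close>

lemma support_case_nat:
  "k \<ge> 1 \<Longrightarrow> {j. case_nat k p j > (0::nat)} = insert 0 (Suc ` {j. p j > 0})"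
  by (rule set_eqI) (simp add: image_iff split: nat.splits)

lemma antimono_case_nat: "antimono (case_nat k p) \<longleftrightarrow> p 0 \<le> k \<and> antimono p"
  by (subst (1 2) antimono_iff_le_Suc) (auto split: nat.splits)

text \<open>Prepending a part \<open>k\<close> inverts the removal of \<open>q 0\<close>. Positivity
  of \<open>k\<close> shifts the support by exactly one index, and \<open>k \<le> n\<close> keeps
  \<open>n - k\<close> from being truncated.\<close>

lemma case_nat_in_int_partitions_iff:
  assumes "1 \<le> k" "k \<le> n"
  shows "case_nat k p \<in> int_partitions n \<longleftrightarrow> p 0 \<le> k \<and> p \<in> int_partitions (n - k)"
proof -
  have "finite (Suc ` {j. p j > 0}) \<longleftrightarrow> finite {j. p j > 0}"
    by (simp add: finite_image_iff)
  moreover have "(\<Sum>j \<in> insert 0 (Suc ` {j. p j > 0}). case_nat k p j) = k + (\<Sum>j | p j > 0. p j)"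
    if "finite {j. p j > 0}"
    using that by (simp add: sum.reindex)
  ultimately show ?thesis
    using assms unfolding int_partitions_def
    by (auto simp: support_case_nat antimono_case_nat)
qed

lemma partition_length_case_nat:
  assumes "k \<ge> 1" "p \<in> int_partitions n"
  shows "partition_length (case_nat k p) = Suc (partition_length p)"
proof -
  have "finite {j. p j > 0}" using assms(2) by (simp add: int_partitions_def)
  then show ?thesis
    using assms(1) by (simp add: partition_length_def support_case_nat card_image)
qed

lemma int_partitions_hd_le:
  assumes "q \<in> int_partitions n"
  shows "q 0 \<le> n"
  using assms member_le_sum[of 0 "{j. q j > 0}" q]
  by (cases "q 0 > 0") (auto simp: int_partitions_def)

lemma partition_transform_0: "partition_transform n 0 a = (if n = 0 then 1 else 0)"
  by (simp add: partition_transform_def int_partitions_0 partition_length_def)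

lemma partition_transform_eq_0:
  assumes "n < k"
  shows "partition_transform n k a = 0"
proof -
  have "{q \<in> int_partitions n. q 0 = k} = {}"
    using assms int_partitions_hd_le by fastforce
  then show ?thesis by (simp only: partition_transform_def sum.empty)
qed

text \<open>Partitions are grouped by their second entry \<open>m\<close>, which together with
  \<open>q 0 = k\<close> fixes the factor at \<open>j = 0\<close>; the tail is a partition of
  \<open>n - k\<close> headed by \<open>m\<close>. The outer \<open>(-1) ^ m\<close> cancels the
  sign inside the inner transform.\<close>

lemma partition_transform_rec:
  assumes k: "1 \<le> k" "k \<le> n"
  shows "partition_transform n k a = (- a 1) ^ k *
    (\<Sum>m\<le>k. (-1) ^ m * of_nat (k choose m) * partition_transform (n - k) m (\<lambda>j. a (Suc j)))"
proof -
  define t where "t q = (-1) ^ q 0 *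
      (\<Prod>j = 0..<partition_length q. of_nat (q j choose q (j + 1)) * a (j + 1) ^ q j)" for q
  define u where "u p = (-1) ^ p 0 *
      (\<Prod>j = 0..<partition_length p. of_nat (p j choose p (j + 1)) * a (Suc (j + 1)) ^ p j)" for p
  define S where "S m = {p \<in> int_partitions (n - k). p 0 = m}" for m
  have t_cons: "t (case_nat k p) = (- a 1) ^ k * ((-1) ^ m * of_nat (k choose m) * u p)"
    if "p \<in> S m" for m p
  proof -
    have p: "p \<in> int_partitions (n - k)" "p 0 = m" using that by (auto simp: S_def)
    have "(\<Prod>j = 0..<Suc l. of_nat (case_nat k p j choose case_nat k p (j + 1)) * a (j + 1) ^ case_nat k p j)
       = of_nat (k choose m) * a 1 ^ k *
         (\<Prod>j = 0..<l. of_nat (p j choose p (j + 1)) * a (Suc (j + 1)) ^ p j)" for l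
      by (subst prod.atLeast0_lessThan_Suc_shift) (simp add: p(2))
    then show ?thesis
      using partition_length_case_nat[OF k(1) p(1)] power_minus[of "a 1" k]
      by (simp add: t_def u_def p(2) mult_ac flip: power_add mult_2_right)
  qed
  have "partition_transform n k a = (\<Sum>q \<in> {q \<in> int_partitions n. q 0 = k}. t q)"
    by (simp add: partition_transform_def t_def)
  also have "\<dots> = (\<Sum>(m, p) \<in> Sigma {..k} S. t (case_nat k p))"
  \<comment> \<open>The component \<open>q 1\<close> is determined by the tail and only records
    which \<open>S m\<close> contains it.\<close>
  proof (rule sum.reindex_bij_witness[where j = "\<lambda>q. (q 1, q \<circ> Suc)" and i = "\<lambda>(m, p). case_nat k p"])
    have cons: "case_nat (q 0) (q \<circ> Suc) = q" for q :: "nat \<Rightarrow> nat"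
      by (auto split: nat.splits)
    fix q assume "q \<in> {q \<in> int_partitions n. q 0 = k}"
    then have q: "q \<in> int_partitions n" and eq: "case_nat k (q \<circ> Suc) = q"
      using cons[of q] by auto
    show "(case (q 1, q \<circ> Suc) of (m, p) \<Rightarrow> case_nat k p) = q"
      using eq by simp
    then show "(case (q 1, q \<circ> Suc) of (m, p) \<Rightarrow> t (case_nat k p)) = t q"
      by simp
    show "(q 1, q \<circ> Suc) \<in> Sigma {..k} S"
      using q case_nat_in_int_partitions_iff[OF k, of "q \<circ> Suc"] by (simp add: eq S_def)
  next
    fix mp assume "mp \<in> Sigma {..k} S"
    then show "((case mp of (m, p) \<Rightarrow> case_nat k p) 1, (case mp of (m, p) \<Rightarrow> case_nat k p) \<circ> Suc) = mp"
      and "(case mp of (m, p) \<Rightarrow> case_nat k p) \<in> {q \<in> int_partitions n. q 0 = k}"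
      by (auto simp: S_def case_nat_in_int_partitions_iff[OF k] fun_eq_iff)
  qed
  also have "\<dots> = (\<Sum>m\<le>k. \<Sum>p\<in>S m. t (case_nat k p))"
    by (rule sum.Sigma[symmetric]) (auto simp: S_def finite_int_partitions)
  also have "\<dots> = (\<Sum>m\<le>k. (- a 1) ^ k * ((-1) ^ m * of_nat (k choose m) * (\<Sum>p\<in>S m. u p)))"
    by (simp add: t_cons sum_distrib_left)
  also have "\<dots> = (- a 1) ^ k *
    (\<Sum>m\<le>k. (-1) ^ m * of_nat (k choose m) * partition_transform (n - k) m (\<lambda>j. a (Suc j)))"
    by (simp add: S_def u_def partition_transform_def sum_distrib_left)
  finally show ?thesis .
qed

lemma partition_transform_ones:
  assumes "n \<ge> 1" "k \<ge> 1"
  shows "partition_transform n k (\<lambda>_. 1) = (-1) ^ k * of_nat ((n - 1) choose (k - 1))"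
  using assms
proof (induction n arbitrary: k rule: less_induct)
  case (less n)
  consider "n < k" | "n = k" | "k < n" by linarith
  then show ?case
  proof cases
    case 1
    then show ?thesis using less.prems by (simp add: partition_transform_eq_0 binomial_eq_0)
  next
    case 2
    \<comment> \<open>Here \<open>n - k = 0\<close>, so only the term \<open>m = 0\<close> survives;
      it lies outside the induction hypothesis and is evaluated directly.\<close>
    have "(\<Sum>m\<le>k. (-1) ^ m * of_nat (k choose m) * partition_transform 0 m (\<lambda>_. 1)) = (1 :: 'a)"
      by (subst sum.remove[of _ 0]) (auto simp: partition_transform_0 partition_transform_eq_0 intro!: sum.neutral)
    then show ?thesis using less.prems 2 by (simp add: partition_transform_rec)
  next
    case 3
    obtain l where l: "k = Suc l" using less.prems by (cases k) auto
    \<comment> \<open>Since \<open>n - k\<close> is positive, the term \<open>m = 0\<close>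
      vanishes, and the shifted index \<open>Suc m\<close> fits the induction hypothesis.\<close>
    have "(\<Sum>m\<le>k. (-1) ^ m * of_nat (k choose m) * partition_transform (n - k) m (\<lambda>_. 1 :: 'a))
        = (\<Sum>m\<le>l. (-1) ^ Suc m * of_nat (k choose Suc m) * partition_transform (n - k) (Suc m) (\<lambda>_. 1))"
      using 3 unfolding l by (subst sum.atMost_Suc_shift) (simp add: partition_transform_0)
    \<comment> \<open>The signs square to one. Reflecting \<open>k choose Suc m\<close>, with
      \<open>k = Suc l\<close>, gives the lower indices the constant sum \<open>l\<close> that
      Vandermonde requires.\<close>
    also have "\<dots> = (\<Sum>m\<le>l. of_nat ((k choose (l - m)) * ((n - k - 1) choose m)))"
    proof (rule sum.cong)
      fix m assume "m \<in> {..l}"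
      then have "k choose Suc m = k choose (l - m)"
        unfolding l by (subst binomial_symmetric) auto
      moreover have "partition_transform (n - k) (Suc m) (\<lambda>_. 1 :: 'a)
          = (-1) ^ Suc m * of_nat ((n - k - 1) choose m)"
        using less.IH[of "n - k" "Suc m"] 3 less.prems by simp
      moreover have "(-1 :: 'a) ^ Suc m * (-1) ^ Suc m = 1"
        by (simp flip: power_add mult_2)
      ultimately show "(-1) ^ Suc m * of_nat (k choose Suc m) * partition_transform (n - k) (Suc m) (\<lambda>_. 1 :: 'a)
          = of_nat ((k choose (l - m)) * ((n - k - 1) choose m))"
        by (simp add: mult_ac)
    qed simp
    also have "\<dots> = of_nat ((n - k - 1 + k) choose l)"
      by (simp add: mult.commute flip: vandermonde)
    also have "n - k - 1 + k = n - 1" using 3 by simp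
    finally show ?thesis
      using 3 less.prems by (simp add: partition_transform_rec l)
  qed
qed

text \<open>Multiplying by \<open>fact k\<close> avoids division, so that the identity can be used
  over the integers.\<close>

lemma falling_factorial_eq_fact:
  "falling_factorial (of_nat (n + k)) n * fact k = (fact (n + k) :: 'a::{comm_ring_1,ring_char_0})"
proof (induction n)
  case 0
  then show ?case by (simp add: falling_factorial_def)
next
  case (Suc n)
  have "falling_factorial (of_nat (Suc n + k)) (Suc n) =
      of_nat (Suc (n + k)) * (falling_factorial (of_nat (n + k)) n :: 'a)"
    unfolding falling_factorial_def by (subst prod.atLeast0_lessThan_Suc_shift) simp
  then show ?case using Suc.IH by (simp add: mult.assoc)
qed

text \<open>The sign in \<open>ward_lah\<close> cancels that of the transform. For
  \<open>k > n\<close> the binomial vanishes, matching the default value 0.\<close>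

lemma ward_lah_closed_form:
  assumes "n \<ge> 1" "k \<ge> 1"
  shows "real_of_int (ward_lah n k) = fact (n + k) / fact k * real ((n - 1) choose (k - 1))"
proof (cases "k > n")
  case True
  then show ?thesis using assms by (simp add: ward_lah_def binomial_eq_0)
next
  case False
  have "(-1 :: int) ^ k * (-1) ^ k = 1" by (simp flip: power_add mult_2)
  then have "ward_lah n k * fact k = fact (n + k) * int ((n - 1) choose (k - 1))"
    using False falling_factorial_eq_fact[of n k, where 'a = int] partition_transform_ones[OF assms, where 'a = int]
    by (simp add: ward_lah_def mult_ac)
  then have "real_of_int (ward_lah n k * fact k) = real_of_int (fact (n + k) * int ((n - 1) choose (k - 1)))"
    by presburger
  then show ?thesis by (simp add: field_simps)
qed

theorem theorem2p6:
  fixes n k :: nat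
  assumes "n \<ge> k" and "k \<ge> 1" and "k - 1 \<ge> 1"
  shows "real_of_int (ward_lah n k) =
    ((real n + real k) * (real n - 1) / real n) *
    (real_of_int (ward_lah (n - 1) k) +
     ((real n + real k - 1) / (real k - 1)) * real_of_int (ward_lah (n - 1) (k - 1)))"
proof -
  \<comment> \<open>Both are at least 2, so the closed form also applies at \<open>n - 1\<close> and
    \<open>k - 1\<close>.\<close>
  have "k = Suc (Suc (k - 2))" "n = Suc (Suc (n - 2))" using assms by simp_all
  then obtain l m where l: "k = Suc (Suc l)" and m: "n = Suc (Suc m)" by blast
  define c where "c = real (Suc m choose Suc l)"
  have c1: "real (Suc l) * c = real (Suc m) * real (m choose l)"
    unfolding c_def by (metis Suc_times_binomial_eq mult.commute of_nat_mult)
  \<comment> \<open>By Pascal's rule, \<open>c - real (m choose l)\<close> is the binomial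
    \<open>(n - 2) choose (k - 1)\<close>.\<close>
  have W: "real_of_int (ward_lah n k) = fact (n + k) / fact k * c"
    "real_of_int (ward_lah (n - 1) k) = fact (n + k - 1) / fact k * (c - real (m choose l))"
    "real_of_int (ward_lah (n - 1) (k - 1)) = fact (n + k - 2) / fact (k - 1) * real (m choose l)"
    using ward_lah_closed_form[of n k] ward_lah_closed_form[of "n - 1" k] ward_lah_closed_form[of "n - 1" "k - 1"]
    by (simp_all add: l m c_def)
  \<comment> \<open>By the absorption identity \<open>c1\<close>, the two binomials are
    \<open>n - 1\<close> and \<open>k - 1\<close> times the common unit \<open>b\<close>.\<close>
  define b where "b = c / real (Suc m)"
  have c: "c = real (Suc m) * b" by (simp add: b_def)
  have b: "real (m choose l) = real (Suc l) * b" using c1 by (simp add: c)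
  define f where "f = (fact (n + k - 2) / fact (k - 1) :: real)"
  have f: "fact (n + k - 1) / fact k = real (n + k - 1) * f / real k"
    "fact (n + k) / fact k = real (n + k) * real (n + k - 1) * f / real k"
    by (simp_all add: f_def l m mult_ac)
  \<comment> \<open>Up to common factors the bracket is \<open>(n - k) / k + 1 = n / k\<close>,
    which cancels the \<open>1 / n\<close> in front.\<close>
  show ?thesis unfolding W f f_def[symmetric] b unfolding c
    by (simp add: l m divide_simps) (simp add: algebra_simps)
qed

end
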